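(* Let $a>0$ and $b>0$. With the functions $V(p,n)=V(p,n,a,b,x)$ defined in the context, the following hold on $(0,\infty)$: $$\int\frac{e^{-ax^{2}}\Gamma(2,bx)}{bx^{2}}\,dx=\frac1bV(-1,1),$$ $$\int\frac{e^{-ax^{2}}\Gamma(3,bx)}{bx^{2}}\,dx=bV(0,0)+\frac2bV(-1,1),$$ $$\int\frac{e^{-ax^{2}}\Gamma(4,bx)}{bx^{2}}\,dx=3bV(0,0)+\frac6bV(-1,1)+b^{2}V(1,0),$$ $$\int\frac{e^{-ax^{2}}\Gamma(5,bx)}{bx^{2}}\,dx=12bV(0,0)+\frac{24}bV(-1,1)+4b^{2}V(1,0)+b^{3}V(2,0),$$ $$\int\frac{e^{-ax^{2}}\Gamma(5,bx)}{bx^{2}}\,dx=b^{3}V(2,0)+4bV(1,1)+\frac8bV(0,2),$$ $$\int\frac{e^{-ax^{2}}\Gamma(5,bx)}{b^{3}x^{4}}\,dx=bV(0,0)+\frac4bV(-1,1)+\frac{8}{b^{3}}V(-2,2),$$ $$\int\frac{e^{-ax^{2}}\Gamma(6,bx)}{b^{3}x^{4}}\,dx=5bV(0,0)+\frac{20}bV(-1,1)+\frac{40}{b^{3}}V(-2,2)+b^{2}V(1,0),$$ $$\int\frac{e^{-ax^{2}}\Gamma(7,bx)}{b^{3}x^{4}}\,dx=30bV(0,0)+\frac{120}bV(-1,1)+\frac{240}{b^{3}}V(-2,2)+5b^{2}V(1,0)+bV(2,1),$$ $$\int e^{-ax^{2}}\Gamma(3,bx)\,dx=b^{2}V(2,0)+2V(1,1),\qquad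 \int e^{-ax^{2}}\Gamma(2,bx)\,dx=V(1,1).$$
   Context: $\Gamma(s,z)=\int_z^\infty t^{s-1}e^{-t}dt$ is the upper incomplete gamma function and $\operatorname{erf}(z)=\frac{2}{\sqrt\pi}\int_0^z e^{-t^2}dt$. With $E=e^{-ax^{2}-bx}$ and $W=\sqrt\pi\,e^{\frac{b^{2}}{4a}}\operatorname{erf}\left(\frac{2ax+b}{2\sqrt a}\right)$: $$V(0,0)=\frac{W}{2\sqrt a},\quad V(1,0)=-\frac{E}{2a}-\frac{bW}{4a^{3/2}},\quad V(2,0)=\frac{(b-2ax)E}{4a^{2}}+\frac{(2a+b^{2})W}{8a^{5/2}},$$ $$V(-1,1)=-\sqrt a\,W-\frac{E}{x},\quad V(1,1)=\frac{(2a-b^{2})W}{4a^{3/2}}-\frac{bE}{2a},\quad V(2,1)=\frac{b\,(b^{2}-2a(1+bx))E}{4a^{2}}+\frac{b^{4}W}{8a^{5/2}},$$ $$V(0,2)=-\frac{(6a-b^{2})W}{2\sqrt a}-\frac{3E}{x},\quad V(-2,2)=2a^{3/2}W+E\left(\frac{2a}{x}-\frac{b}{x^{2}}-\frac1{x^{3}}\right).$$ $\int f\,dx=F$ means that $F$ is an antiderivative of $f$ on $(0,\infty)$. *)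

theory Defs
  imports "HOL-Analysis.Analysis"
begin

definition upper_Gamma :: "real \<Rightarrow> real \<Rightarrow> real" where
  "upper_Gamma s z = (LBINT t=ereal z..\<infinity>. t powr (s - 1) * exp (- t))"

(* The interval integral is oriented, so erf is odd. *)
definition erf :: "real \<Rightarrow> real" where
  "erf z = 2 / sqrt pi * (LBINT t=ereal 0..ereal z. exp (- t\<^sup>2))"

definition E_fun :: "real \<Rightarrow> real \<Rightarrow> real \<Rightarrow> real" where
  "E_fun a b x = exp (- a * x\<^sup>2 - b * x)"

definition W_fun :: "real \<Rightarrow> real \<Rightarrow> real \<Rightarrow> real" where
  "W_fun a b x = sqrt pi * exp (b\<^sup>2 / (4 * a)) * erf ((2 * a * x + b) / (2 * sqrt a))"

(* V is given by a finite table of explicit formulas; it is left unspecified at all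
   other index pairs. *)
definition V :: "int \<Rightarrow> nat \<Rightarrow> real \<Rightarrow> real \<Rightarrow> real \<Rightarrow> real" where
  "V p n a b x = (let E = E_fun a b x; W = W_fun a b x in
     if p = 0 \<and> n = 0 then W / (2 * sqrt a)
     else if p = 1 \<and> n = 0 then - E / (2 * a) - b * W / (4 * a powr (3/2))
     else if p = 2 \<and> n = 0 then
       (b - 2 * a * x) * E / (4 * a\<^sup>2) + (2 * a + b\<^sup>2) * W / (8 * a powr (5/2))
     else if p = -1 \<and> n = 1 then - sqrt a * W - E / x
     else if p = 1 \<and> n = 1 then
       (2 * a - b\<^sup>2) * W / (4 * a powr (3/2)) - b * E / (2 * a)
     else if p = 2 \<and> n = 1 then
       b * (b\<^sup>2 - 2 * a * (1 + b * x)) * E / (4 * a\<^sup>2) + b ^ 4 * W / (8 * a powr (5/2))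
     else if p = 0 \<and> n = 2 then - (6 * a - b\<^sup>2) * W / (2 * sqrt a) - 3 * E / x
     else if p = -2 \<and> n = 2 then
       2 * a powr (3/2) * W + E * (2 * a / x - b / x\<^sup>2 - 1 / x ^ 3)
     else undefined)"

definition antiderivative_on :: "real set \<Rightarrow> (real \<Rightarrow> real) \<Rightarrow> (real \<Rightarrow> real) \<Rightarrow> bool" where
  "antiderivative_on S f F \<longleftrightarrow> (\<forall>x\<in>S. (F has_real_derivative f x) (at x within S))"

end

(* Repeated integration by parts gives Gamma(n+1, z) = n! exp(-z) (sum of z^k/k! for k <= n), so that
   each integrand is E times a Laurent polynomial in x. Completing the square in the argument of erf
   gives W' = 2 sqrt(a) E, while E' = -(2 a x + b) E; hence the derivative of every V(p,n) is again E
   times a Laurent polynomial, and each identity reduces to comparing two such polynomials. *)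
theory Submission
  imports Defs
begin

text \<open>Differentiating \<open>exp (- t)\<close> times the partial sum telescopes: only the top
  term \<open>t ^ n / fact n\<close> survives. The factor and sign are chosen so that this is an
  antiderivative of the integrand of Gamma(n+1, z).\<close>

lemma has_real_derivative_exp_partial_sum:
  "((\<lambda>t. - exp (- t) * fact n * (\<Sum>k\<le>n. t ^ k / fact k)) has_real_derivative
     t ^ n * exp (- t)) (at t)"
proof (induction n)
  case 0
  show ?case by (auto intro!: derivative_eq_intros)
next
  case (Suc n)
  \<comment> \<open>Integration by parts as a recurrence: splitting off the top summand leaves
    \<open>n + 1\<close> times the previous antiderivative. The derivative of the split-off term
    cancels the contribution of the induction hypothesis.\<close>
  have *: "- exp (- t) * fact (Suc n) * (\<Sum>k\<le>Suc n. t ^ k / fact k) =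
      real (Suc n) * (- exp (- t) * fact n * (\<Sum>k\<le>n. t ^ k / fact k)) - exp (- t) * t ^ Suc n"
    for t :: real
    by (simp add: field_simps del: of_nat_Suc)
  show ?case
    unfolding *
    by (rule derivative_eq_intros Suc.IH refl | simp add: algebra_simps)+
qed

text \<open>Each \<open>t ^ k\<close> is negligible against \<open>exp t\<close>. This supplies the
  boundary value at infinity for the incomplete gamma integral.\<close>

lemma tendsto_exp_partial_sum_at_top:
  "((\<lambda>t::real. - exp (- t) * fact n * (\<Sum>k\<le>n. t ^ k / fact k)) \<longlongrightarrow> 0) at_top"
proof -
  have "((\<lambda>t::real. \<Sum>k\<le>n. (- fact n / fact k) * (t ^ k / exp t)) \<longlongrightarrow> (\<Sum>k\<le>n. (- fact n / fact k) * 0)) at_top"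
    by (intro tendsto_intros tendsto_power_div_exp_0)
  moreover have "- exp (- t) * fact n * (\<Sum>k\<le>n. t ^ k / fact k) =
      (\<Sum>k\<le>n. (- fact n / fact k) * (t ^ k / exp t))" for t :: real
    unfolding sum_distrib_left by (intro sum.cong) (simp_all add: exp_minus field_simps)
  ultimately show ?thesis by simp
qed

lemma upper_Gamma_Suc:
  assumes "z > 0"
  shows "upper_Gamma (real n + 1) z = exp (- z) * fact n * (\<Sum>k\<le>n. z ^ k / fact k)"
proof -
  let ?F = "\<lambda>t::real. - exp (- t) * fact n * (\<Sum>k\<le>n. t ^ k / fact k)"
  have "upper_Gamma (real n + 1) z = 0 - ?F z"
    unfolding upper_Gamma_def
  \<comment> \<open>For a nonnegative integrand the one-sided limits of \<open>?F\<close> at both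
    endpoints suffice, so integrability needs no separate proof.\<close>
  proof (rule interval_integral_FTC_nonneg(2))
    fix t assume "ereal z < ereal t" "ereal t < \<infinity>"
    \<comment> \<open>Positivity turns \<open>powr\<close> with exponent \<open>real n\<close> into
      the ordinary power \<open>t ^ n\<close>.\<close>
    then have t: "t > 0" using assms by simp
    show "(?F has_real_derivative t powr (real n + 1 - 1) * exp (- t)) (at t)"
      using has_real_derivative_exp_partial_sum[of n t] t by (simp add: powr_realpow)
    show "isCont (\<lambda>t. t powr (real n + 1 - 1) * exp (- t)) t"
      using t by (intro continuous_intros) auto
  next
    have "isCont ?F z"
      using has_real_derivative_exp_partial_sum DERIV_isCont by blast
    then show "((?F \<circ> real_of_ereal) \<longlongrightarrow> ?F z) (at_right (ereal z))"
      unfolding isCont_def filterlim_at_split ereal_tendsto_simps1 by blast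
  next
    show "((?F \<circ> real_of_ereal) \<longlongrightarrow> 0) (at_left \<infinity>)"
      using tendsto_exp_partial_sum_at_top by (simp add: ereal_tendsto_simps1)
  qed auto
  then show ?thesis by simp
qed

lemma has_real_derivative_erf:
  "(erf has_real_derivative 2 / sqrt pi * exp (- x\<^sup>2)) (at x)"
proof -
  \<comment> \<open>The interval from \<open>- ?r\<close> to \<open>?r\<close> contains the base
    point 0 and has \<open>x\<close> in its interior, so the derivative within it is the full
    derivative.\<close>
  let ?r = "\<bar>x\<bar> + 1"
  have "((\<lambda>u. LBINT t=ereal 0..ereal u. exp (- t\<^sup>2)) has_vector_derivative exp (- x\<^sup>2))
      (at x within {- ?r..?r})"
    by (rule interval_integral_FTC2) (auto intro!: continuous_intros)
  moreover have "at x within {- ?r..?r} = at x"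
    by (rule at_within_interior) auto
  ultimately have "((\<lambda>u. LBINT t=ereal 0..ereal u. exp (- t\<^sup>2)) has_real_derivative exp (- x\<^sup>2)) (at x)"
    by (simp add: has_real_derivative_iff_has_vector_derivative)
  then show ?thesis
    unfolding erf_def by (rule DERIV_cmult)
qed

lemma has_real_derivative_E_fun:
  "(E_fun a b has_real_derivative - (2 * a * x + b) * E_fun a b x) (at x within S)"
  unfolding E_fun_def by (auto intro!: derivative_eq_intros simp: algebra_simps)

lemma has_real_derivative_W_fun:
  assumes "a > 0"
  shows "(W_fun a b has_real_derivative 2 * sqrt a * E_fun a b x) (at x within S)"
proof -
  define y where "y = (2 * a * x + b) / (2 * sqrt a)"
  \<comment> \<open>Completing the square: the constant \<open>exp (b\<^sup>2 / (4 * a))\<close> in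
    \<open>W_fun\<close> is exactly what turns the Gaussian in \<open>y\<close> into
    \<open>E_fun\<close>.\<close>
  have y2: "b\<^sup>2 / (4 * a) - y\<^sup>2 = - a * x\<^sup>2 - b * x"
  proof -
    have "y\<^sup>2 = (2 * a * x + b)\<^sup>2 / (4 * a)"
      using assms by (simp add: y_def power_divide power_mult_distrib)
    then show ?thesis
      using assms by (simp add: field_simps power2_eq_square)
  qed
  have lin: "((\<lambda>x. (2 * a * x + b) / (2 * sqrt a)) has_real_derivative sqrt a) (at x within S)"
    using assms by (auto intro!: derivative_eq_intros simp: field_simps)
  have "((\<lambda>x. sqrt pi * exp (b\<^sup>2 / (4 * a)) * erf ((2 * a * x + b) / (2 * sqrt a))) has_real_derivative
      sqrt pi * exp (b\<^sup>2 / (4 * a)) * (2 / sqrt pi * exp (- y\<^sup>2) * sqrt a)) (at x within S)"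
    unfolding y_def by (intro DERIV_cmult DERIV_chain2[OF has_real_derivative_erf lin])
  moreover have "sqrt pi * exp (b\<^sup>2 / (4 * a)) * (2 / sqrt pi * exp (- y\<^sup>2) * sqrt a) =
      2 * sqrt a * (exp (b\<^sup>2 / (4 * a)) * exp (- y\<^sup>2))"
    by simp
  moreover have "exp (b\<^sup>2 / (4 * a)) * exp (- y\<^sup>2) = exp (- a * x\<^sup>2 - b * x)"
    unfolding y2[symmetric] by (simp flip: exp_add)
  ultimately show ?thesis
    unfolding W_fun_def E_fun_def by (simp only:)
qed

text \<open>Rewrites the fractional powers in the table of \<open>V\<close> so that
  \<open>sqrt a\<close> is the only irrational quantity left, and it cancels against the
  \<open>sqrt a\<close> in the derivative of \<open>W_fun\<close>.\<close>

lemma powr_half_odd: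
  fixes a :: real
  assumes "a > 0"
  shows "a powr (3/2) = a * sqrt a" "a powr (5/2) = a\<^sup>2 * sqrt a"
proof -
  have "a powr (1 + 1/2) = a * sqrt a" "a powr (2 + 1/2) = a\<^sup>2 * sqrt a"
    using assms by (simp_all only: powr_add powr_half_sqrt powr_one powr_numeral less_imp_le)
  then show "a powr (3/2) = a * sqrt a" "a powr (5/2) = a\<^sup>2 * sqrt a" by simp_all
qed

text \<open>An entry \<open>c * W + R(x) * E\<close> has derivative
  \<open>(2 * sqrt a * c + R'(x) - (2 * a * x + b) * R(x)) * E\<close>. The results follow a
  pattern: x^(p-n) times the reverse Bessel polynomial of degree n in \<open>b * x\<close> (1, 1 +
  z, 3 + 3z + z^2), except that the entry (2,1) carries an extra factor \<open>b\<close>.\<close>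

lemma has_real_derivative_V:
  assumes a: "a > 0" and x: "x > 0"
  shows "(V 0 0 a b has_real_derivative E_fun a b x) (at x within S)" (is ?V00)
    "(V 1 0 a b has_real_derivative x * E_fun a b x) (at x within S)" (is ?V10)
    "(V 2 0 a b has_real_derivative x\<^sup>2 * E_fun a b x) (at x within S)" (is ?V20)
    "(V (-1) 1 a b has_real_derivative (1 + b * x) / x\<^sup>2 * E_fun a b x) (at x within S)" (is ?Vm11)
    "(V 1 1 a b has_real_derivative (1 + b * x) * E_fun a b x) (at x within S)" (is ?V11)
    "(V 2 1 a b has_real_derivative (b * x + b\<^sup>2 * x\<^sup>2) * E_fun a b x) (at x within S)" (is ?V21)
    "(V 0 2 a b has_real_derivative
        (3 + 3 * b * x + b\<^sup>2 * x\<^sup>2) / x\<^sup>2 * E_fun a b x) (at x within S)" (is ?V02)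
    "(V (-2) 2 a b has_real_derivative
        (3 + 3 * b * x + b\<^sup>2 * x\<^sup>2) / x ^ 4 * E_fun a b x) (at x within S)" (is ?Vm22)
proof -
  note [simp] = powr_half_odd[OF a]
  have [simp]: "a \<noteq> 0" "x \<noteq> 0" using a x by auto
  note W = has_real_derivative_W_fun[OF a, of b x S]
  note E = has_real_derivative_E_fun[of a b x S]
  \<comment> \<open>Fixing the indices resolves the case distinction in \<open>V_def\<close>. The
    equation is between functions, so it can rewrite the partially applied \<open>V\<close> under
    the derivative; the other entries go the same way.\<close>
  have "V 0 0 a b = (\<lambda>x. W_fun a b x / (2 * sqrt a))"
    by (simp add: V_def Let_def fun_eq_iff)
  then show ?V00
    using a x by (auto intro!: derivative_eq_intros W E
      simp: field_simps power2_eq_square power3_eq_cube power4_eq_xxxx)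
  have "V 1 0 a b = (\<lambda>x. - E_fun a b x / (2 * a) - b * W_fun a b x / (4 * (a * sqrt a)))"
    by (simp add: V_def Let_def fun_eq_iff)
  then show ?V10
    using a x by (auto intro!: derivative_eq_intros W E
      simp: field_simps power2_eq_square power3_eq_cube power4_eq_xxxx)
  have "V 2 0 a b = (\<lambda>x. (b - 2 * a * x) * E_fun a b x / (4 * a\<^sup>2) + (2 * a + b\<^sup>2) * W_fun a b x / (8 * (a\<^sup>2 * sqrt a)))"
    by (simp add: V_def Let_def fun_eq_iff)
  then show ?V20
    using a x by (auto intro!: derivative_eq_intros W E
      simp: field_simps power2_eq_square power3_eq_cube power4_eq_xxxx)
  have "V (-1) 1 a b = (\<lambda>x. - sqrt a * W_fun a b x - E_fun a b x / x)"
    by (simp add: V_def Let_def fun_eq_iff)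
  then show ?Vm11
    using a x by (auto intro!: derivative_eq_intros W E
      simp: field_simps power2_eq_square power3_eq_cube power4_eq_xxxx)
  have "V 1 1 a b = (\<lambda>x. (2 * a - b\<^sup>2) * W_fun a b x / (4 * (a * sqrt a)) - b * E_fun a b x / (2 * a))"
    by (simp add: V_def Let_def fun_eq_iff)
  then show ?V11
    using a x by (auto intro!: derivative_eq_intros W E
      simp: field_simps power2_eq_square power3_eq_cube power4_eq_xxxx)
  have "V 2 1 a b = (\<lambda>x. b * (b\<^sup>2 - 2 * a * (1 + b * x)) * E_fun a b x / (4 * a\<^sup>2) + b ^ 4 * W_fun a b x / (8 * (a\<^sup>2 * sqrt a)))"
    by (simp add: V_def Let_def fun_eq_iff)
  then show ?V21
    using a x by (auto intro!: derivative_eq_intros W E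
      simp: field_simps power2_eq_square power3_eq_cube power4_eq_xxxx)
  have "V 0 2 a b = (\<lambda>x. - (6 * a - b\<^sup>2) * W_fun a b x / (2 * sqrt a) - 3 * E_fun a b x / x)"
    by (simp add: V_def Let_def fun_eq_iff)
  then show ?V02
    using a x by (auto intro!: derivative_eq_intros W E
      simp: field_simps power2_eq_square power3_eq_cube power4_eq_xxxx)
  have "V (-2) 2 a b = (\<lambda>x. 2 * (a * sqrt a) * W_fun a b x + E_fun a b x * (2 * a / x - b / x\<^sup>2 - 1 / x ^ 3))"
    by (simp add: V_def Let_def fun_eq_iff)
  then show ?Vm22
    using a x by (auto intro!: derivative_eq_intros W E
      simp: field_simps power2_eq_square power3_eq_cube power4_eq_xxxx)
qed

lemma upper_Gamma_numeral:
  assumes "z > 0"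
  shows "upper_Gamma 2 z = exp (- z) * (1 + z)"
    "upper_Gamma 3 z = exp (- z) * (2 + 2 * z + z ^ 2)"
    "upper_Gamma 4 z = exp (- z) * (6 + 6 * z + 3 * z ^ 2 + z ^ 3)"
    "upper_Gamma 5 z = exp (- z) * (24 + 24 * z + 12 * z ^ 2 + 4 * z ^ 3 + z ^ 4)"
    "upper_Gamma 6 z = exp (- z) * (120 + 120 * z + 60 * z ^ 2 + 20 * z ^ 3 + 5 * z ^ 4 + z ^ 5)"
    "upper_Gamma 7 z = exp (- z) *
       (720 + 720 * z + 360 * z ^ 2 + 120 * z ^ 3 + 30 * z ^ 4 + 6 * z ^ 5 + z ^ 6)"
  \<comment> \<open>The instance at n evaluates the first argument n + 1; the coefficient of z^k is
    n!/k!.\<close>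
  using upper_Gamma_Suc[OF assms, of 1] upper_Gamma_Suc[OF assms, of 2]
    upper_Gamma_Suc[OF assms, of 3] upper_Gamma_Suc[OF assms, of 4]
    upper_Gamma_Suc[OF assms, of 5] upper_Gamma_Suc[OF assms, of 6]
  by (simp_all add: fact_numeral eval_nat_numeral algebra_simps)

theorem mainTheorem9:
  fixes a b :: real
  assumes "a > 0" and "b > 0"
  shows
    "antiderivative_on {0<..}
      (\<lambda>x. (exp (- a * x\<^sup>2) * upper_Gamma 2 (b * x)) / (b * x\<^sup>2))
      (\<lambda>x. 1 / b * V (-1) 1 a b x) \<and>
     antiderivative_on {0<..}
      (\<lambda>x. (exp (- a * x\<^sup>2) * upper_Gamma 3 (b * x)) / (b * x\<^sup>2))
      (\<lambda>x. b * V 0 0 a b x + 2 / b * V (-1) 1 a b x) \<and>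
     antiderivative_on {0<..}
      (\<lambda>x. (exp (- a * x\<^sup>2) * upper_Gamma 4 (b * x)) / (b * x\<^sup>2))
      (\<lambda>x. 3 * b * V 0 0 a b x + 6 / b * V (-1) 1 a b x + b\<^sup>2 * V 1 0 a b x) \<and>
     antiderivative_on {0<..}
      (\<lambda>x. (exp (- a * x\<^sup>2) * upper_Gamma 5 (b * x)) / (b * x\<^sup>2))
      (\<lambda>x. 12 * b * V 0 0 a b x + 24 / b * V (-1) 1 a b x + 4 * b\<^sup>2 * V 1 0 a b x
          + b ^ 3 * V 2 0 a b x) \<and>
     antiderivative_on {0<..}
      (\<lambda>x. (exp (- a * x\<^sup>2) * upper_Gamma 5 (b * x)) / (b * x\<^sup>2))
      (\<lambda>x. b ^ 3 * V 2 0 a b x + 4 * b * V 1 1 a b x + 8 / b * V 0 2 a b x) \<and>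
     antiderivative_on {0<..}
      (\<lambda>x. (exp (- a * x\<^sup>2) * upper_Gamma 5 (b * x)) / (b ^ 3 * x ^ 4))
      (\<lambda>x. b * V 0 0 a b x + 4 / b * V (-1) 1 a b x + 8 / b ^ 3 * V (-2) 2 a b x) \<and>
     antiderivative_on {0<..}
      (\<lambda>x. (exp (- a * x\<^sup>2) * upper_Gamma 6 (b * x)) / (b ^ 3 * x ^ 4))
      (\<lambda>x. 5 * b * V 0 0 a b x + 20 / b * V (-1) 1 a b x + 40 / b ^ 3 * V (-2) 2 a b x
          + b\<^sup>2 * V 1 0 a b x) \<and>
     antiderivative_on {0<..}
      (\<lambda>x. (exp (- a * x\<^sup>2) * upper_Gamma 7 (b * x)) / (b ^ 3 * x ^ 4))
      (\<lambda>x. 30 * b * V 0 0 a b x + 120 / b * V (-1) 1 a b x + 240 / b ^ 3 * V (-2) 2 a b x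
          + 5 * b\<^sup>2 * V 1 0 a b x + b * V 2 1 a b x) \<and>
     antiderivative_on {0<..}
      (\<lambda>x. exp (- a * x\<^sup>2) * upper_Gamma 3 (b * x))
      (\<lambda>x. b\<^sup>2 * V 2 0 a b x + 2 * V 1 1 a b x) \<and>
     antiderivative_on {0<..}
      (\<lambda>x. exp (- a * x\<^sup>2) * upper_Gamma 2 (b * x))
      (\<lambda>x. V 1 1 a b x)"
proof -
  \<comment> \<open>Merges the Gaussian with the factor \<open>exp (- (b * x))\<close> coming from
    the incomplete gamma function.\<close>
  have E: "exp (- (a * x\<^sup>2)) * (exp (- (b * x)) * c) = c * E_fun a b x" for x c
    by (simp add: E_fun_def exp_diff exp_minus field_simps)
  show ?thesis
    unfolding antiderivative_on_def Ball_def greaterThan_iff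
    \<comment> \<open>\<open>DERIV_cong\<close> separates differentiating the combination of
      \<open>V\<close> entries from matching the result with the integrand. What remains compares
      Laurent polynomials in \<open>x\<close>; \<open>b > 0\<close> makes \<open>b * x\<close>
      positive, as the gamma formulas require. The two evaluations with the same integrand are two
      decompositions of one such polynomial.\<close>
    by (intro conjI allI impI;
        rule DERIV_cong,
        (rule DERIV_add DERIV_cmult has_real_derivative_V assms | assumption)+,
        simp add: upper_Gamma_numeral E assms,
        (use assms in \<open>simp add: field_simps eval_nat_numeral\<close>)?)
qed

end
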